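(* Let $R$ be a refinement function, $T$ a target cell selector and $\phi$ a node invariant, and consider any $G\in\mathcal{G}$ and $\pi_0\in\Pi$. Starting from the search tree $\mathcal{T}(G,\pi_0)$, pruning operations (as defined in the context) are applied successively. (a) Suppose any sequence of operations of the form $P_A(\nu,\nu')$ or $P_C(\nu,g)$ is performed. Then there remains at least one leaf $\nu_1$ with $\phi(G,\pi_0,\nu_1)=\phi^*(G,\pi_0)$. (b) Let $\nu_0$ be some fixed leaf of $\mathcal{T}(G,\pi_0)$. Suppose any sequence of operations of the form $P_B(\nu,\nu')$ or $P_C(\nu'',g)$ is performed, where $\phi(G,\pi_0,\nu'')\ne\phi(G,\pi_0,[\nu_0]_{|\nu''|})$. Let $g_1,\dots,g_k$ be the automorphisms used in the operations $P_C$ that were performed, and let $A=\{g\in\operatorname{Aut}(G,\pi_0):\nu_0^g\text{ is a remaining leaf}\}$. Then $\operatorname{Aut}(G,\pi_0)$ is generated by $\{g_1,\dots,g_k\}\cup A$.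
   Context: Let $V=\{1,\dots,n\}$ and let $\mathcal{G}$ be the set of graphs with vertex set $V$. A colouring of $V$ is a surjective function $\pi:V\to\{1,\dots,k\}$ for some $k$; $\Pi$ denotes the set of all colourings. A cell of $\pi$ is a set $\pi^{-1}(j)$; $\pi$ is discrete if every cell is a singleton, in which case $\pi$ is a permutation of $V$. For colourings $\pi,\pi'$, write $\pi'\preceq\pi$ if $\pi(v)<\pi(w)$ implies $\pi'(v)<\pi'(w)$ for all $v,w\in V$. The symmetric group $S_n$ acts on $V$ with $v^g$ the image of $v$ under $g$; for $W\subseteq V$, $W^g=\{w^g:w\in W\}$, and sequences are mapped componentwise; $G^g$ is the graph in which $v^g,w^g$ are adjacent iff $v,w$ are adjacent in $G$; for a colouring $\pi$, $\pi^g$ is the colouring with $\pi^g(v)=\pi(v^g)$; $(G,\pi)^g=(G^g,\pi^g)$; $\operatorname{Aut}(G,\pi)=\{g\in S_n:(G,\pi)^g=(G,\pi)\}$. $V^*$ denotes the set of finite sequences of vertices; $|\nu|$ is the length of $\nu$; for $\nu=(v_1,\dots,v_k)$ and $w\in V$, $\nu\Vert w=(v_1,\dots,v_k,w)$; for $0\le s\le k$, $[\nu]_s=(v_1,\dots,v_s)$; "$v\in\nu$" means $v$ is a component of $\nu$. The order $\le$ on $V^*$ is lexicographic: $\nu\le\nu'$ if $\nu$ is a prefix of $\nu'$ or there is $j$ with $v_i=v_i'$ for $i<j$ and $v_j<v_j'$. A refinement function is a function $R:\mathcal{G}\times\Pi\times V^*\to\Pi$ such that for all $G,\pi,\nu$: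 (R1) $R(G,\pi,\nu)\preceq\pi$; (R2) if $v\in\nu$ then $\{v\}$ is a cell of $R(G,\pi,\nu)$; (R3) for all $g\in S_n$, $R(G^g,\pi^g,\nu^g)=R(G,\pi,\nu)^g$. A target cell selector (for $R$) is a function $T:\mathcal{G}\times\Pi\times V^*\to 2^V$ such that for all $G,\pi,\nu$: (T1) if $R(G,\pi,\nu)$ is discrete then $T(G,\pi,\nu)=\emptyset$; (T2) if $R(G,\pi,\nu)$ is not discrete then $T(G,\pi,\nu)$ is a non-singleton cell of $R(G,\pi,\nu)$; (T3) for all $g\in S_n$, $T(G^g,\pi^g,\nu^g)=T(G,\pi,\nu)^g$. The search tree $\mathcal{T}(G,\pi_0)$ is the rooted tree whose nodes are elements of $V^*$: the root is $()$, and the children of a node $\nu$ are the sequences $\nu\Vert w$ for $w\in T(G,\pi_0,\nu)$. $\mathcal{T}(G,\pi_0,\nu)$ is the subtree consisting of $\nu$ and its descendants. A leaf is a node $\nu$ of $\mathcal{T}(G,\pi_0)$ with $R(G,\pi_0,\nu)$ discrete (this meaning is kept even after pruning). Let $\Omega$ be a totally ordered set. A node invariant is a function $\phi:\mathcal{G}\times\Pi\times V^*\to\Omega$ such that for all $\pi_0\in\Pi$, $G\in\mathcal{G}$ and distinct nodes $\nu,\nu'$ of $\mathcal{T}(G,\pi_0)$: ($\phi$1) if $|\nu|=|\nu'|$ and $\phi(G,\pi_0,\nu)<\phi(G,\pi_0,\nu')$, then $\phi(G,\pi_0,\nu_1)<\phi(G,\pi_0,\nu_1')$ for every leaf $\nu_1$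 of $\mathcal{T}(G,\pi_0,\nu)$ and every leaf $\nu_1'$ of $\mathcal{T}(G,\pi_0,\nu')$; ($\phi$2) if $\pi=R(G,\pi_0,\nu)$ and $\pi'=R(G,\pi_0,\nu')$ are discrete, then $\phi(G,\pi_0,\nu)=\phi(G,\pi_0,\nu')$ iff $G^\pi=G^{\pi'}$ (equality of graphs); ($\phi$3) for all $g\in S_n$, $\phi(G^g,\pi_0^g,\nu^g)=\phi(G,\pi_0,\nu)$. Let $\phi^*(G,\pi_0)=\max\{\phi(G,\pi_0,\nu):\nu\text{ a leaf of }\mathcal{T}(G,\pi_0)\}$. Pruning operations on $\mathcal{T}(G,\pi_0)$: (A) if $\nu,\nu'$ are distinct nodes of $\mathcal{T}(G,\pi_0)$ with $|\nu|=|\nu'|$ and $\phi(G,\pi_0,\nu)>\phi(G,\pi_0,\nu')$, operation $P_A(\nu,\nu')$ removes $\mathcal{T}(G,\pi_0,\nu')$; (B) if $\nu,\nu'$ are distinct nodes with $|\nu|=|\nu'|$ and $\phi(G,\pi_0,\nu)\ne\phi(G,\pi_0,\nu')$, operation $P_B(\nu,\nu')$ removes $\mathcal{T}(G,\pi_0,\nu')$; (C) if $g\in\operatorname{Aut}(G,\pi_0)$ and $\nu<\nu'$ are nodes with $\nu^g=\nu'$, operation $P_C(\nu,g)$ removes $\mathcal{T}(G,\pi_0,\nu')$. A leaf is "remaining" if it has not been removed by any of the performed operations.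
   Formalization: Colourings are moved by π^g(v^g)=π(v) instead of π^g(v)=π(v^g), under which no refinement function exists for n≥3. In (b) the condition φ≠φ([ν_0]) is imposed on the node ν' removed by P_B(ν,ν'), without which (b) fails, and is not imposed on ν'' in P_C(ν'',g). *)

theory Defs
  imports
    "HOL-Algebra.Sym_Groups"
    "HOL-Library.FuncSet"
begin

abbreviation vertices :: "nat \<Rightarrow> nat set"
  where "vertices n \<equiv> {1..n}"

text \<open>Simple graphs are represented by their sets of edges.\<close>

definition graphs :: "nat \<Rightarrow> nat set set set"
  where "graphs n = {G. \<forall>e\<in>G. e \<subseteq> vertices n \<and> card e = 2}"

text \<open>Colourings are extensional, so that equality of functions is equality on the vertices.\<close>

definition colourings :: "nat \<Rightarrow> (nat \<Rightarrow> nat) set"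
  where "colourings n = {\<pi> \<in> extensional (vertices n). \<exists>k. \<pi> ` vertices n = {1..k}}"

definition cells :: "nat \<Rightarrow> (nat \<Rightarrow> nat) \<Rightarrow> nat set set"
  where "cells n \<pi> = {{v \<in> vertices n. \<pi> v = j} |j. j \<in> \<pi> ` vertices n}"

definition discrete :: "nat \<Rightarrow> (nat \<Rightarrow> nat) \<Rightarrow> bool"
  where "discrete n \<pi> \<longleftrightarrow> (\<forall>C\<in>cells n \<pi>. is_singleton C)"

definition finer :: "nat \<Rightarrow> (nat \<Rightarrow> nat) \<Rightarrow> (nat \<Rightarrow> nat) \<Rightarrow> bool"
  where "finer n \<pi>' \<pi> \<longleftrightarrow> (\<forall>v\<in>vertices n. \<forall>w\<in>vertices n. \<pi> v < \<pi> w \<longrightarrow> \<pi>' v < \<pi>' w)"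

text \<open>
  The image of a vertex \<open>v\<close> under a permutation \<open>g\<close> is \<open>g v\<close>, that of a set \<open>W\<close> is \<open>g ` W\<close>, and
  that of a sequence \<open>\<nu>\<close> is \<open>map g \<nu>\<close>. The function \<open>graph_act\<close> is also applied to a discrete
  colouring, which is a permutation of the vertices.
\<close>

definition graph_act :: "(nat \<Rightarrow> nat) \<Rightarrow> nat set set \<Rightarrow> nat set set"
  where "graph_act g G = (\<lambda>e. g ` e) ` G"

text \<open>
  The vertex \<open>g v\<close> receives in the permuted colouring the colour that \<open>v\<close> has in \<open>\<pi>\<close>. The
  definition sometimes found in print, by which \<open>v\<close> receives the colour \<open>\<pi> (g v)\<close>, moves
  colourings by the inverse of \<open>g\<close> while graphs and sequences are moved by \<open>g\<close>. Both definitions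
  give the same automorphism groups, and they agree for \<open>n \<le> 2\<close>; but for \<open>n \<ge> 3\<close> no function
  satisfies the refinement axioms below with the other one (consider the empty graph, the constant
  colouring and sequences of length 1).
\<close>

definition col_act :: "(nat \<Rightarrow> nat) \<Rightarrow> (nat \<Rightarrow> nat) \<Rightarrow> (nat \<Rightarrow> nat)"
  where "col_act g \<pi> = \<pi> \<circ> inv_into UNIV g"

definition Aut :: "nat \<Rightarrow> nat set set \<Rightarrow> (nat \<Rightarrow> nat) \<Rightarrow> (nat \<Rightarrow> nat) set"
  where "Aut n G \<pi> = {g \<in> carrier (sym_group n). graph_act g G = G \<and> col_act g \<pi> = \<pi>}"

definition refinement_function ::
  "nat \<Rightarrow> (nat set set \<Rightarrow> (nat \<Rightarrow> nat) \<Rightarrow> nat list \<Rightarrow> (nat \<Rightarrow> nat)) \<Rightarrow> bool"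
  where "refinement_function n R \<longleftrightarrow>
    (\<forall>G\<in>graphs n. \<forall>\<pi>\<in>colourings n. \<forall>\<nu>\<in>lists (vertices n).
      R G \<pi> \<nu> \<in> colourings n \<and>
      finer n (R G \<pi> \<nu>) \<pi> \<and>
      (\<forall>v\<in>set \<nu>. {v} \<in> cells n (R G \<pi> \<nu>)) \<and>
      (\<forall>g\<in>carrier (sym_group n).
        R (graph_act g G) (col_act g \<pi>) (map g \<nu>) = col_act g (R G \<pi> \<nu>)))"

definition target_cell_selector ::
  "nat \<Rightarrow> (nat set set \<Rightarrow> (nat \<Rightarrow> nat) \<Rightarrow> nat list \<Rightarrow> (nat \<Rightarrow> nat)) \<Rightarrow>
    (nat set set \<Rightarrow> (nat \<Rightarrow> nat) \<Rightarrow> nat list \<Rightarrow> nat set) \<Rightarrow> bool"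
  where "target_cell_selector n R T \<longleftrightarrow>
    (\<forall>G\<in>graphs n. \<forall>\<pi>\<in>colourings n. \<forall>\<nu>\<in>lists (vertices n).
      (discrete n (R G \<pi> \<nu>) \<longrightarrow> T G \<pi> \<nu> = {}) \<and>
      (\<not> discrete n (R G \<pi> \<nu>) \<longrightarrow> T G \<pi> \<nu> \<in> cells n (R G \<pi> \<nu>) \<and> \<not> is_singleton (T G \<pi> \<nu>)) \<and>
      (\<forall>g\<in>carrier (sym_group n).
        T (graph_act g G) (col_act g \<pi>) (map g \<nu>) = g ` T G \<pi> \<nu>))"

inductive_set subtree ::
  "(nat set set \<Rightarrow> (nat \<Rightarrow> nat) \<Rightarrow> nat list \<Rightarrow> nat set) \<Rightarrow> nat set set \<Rightarrow> (nat \<Rightarrow> nat) \<Rightarrow>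
    nat list \<Rightarrow> nat list set"
  for T G \<pi>\<^sub>0 \<nu> where
  top: "\<nu> \<in> subtree T G \<pi>\<^sub>0 \<nu>"
| child: "\<mu> \<in> subtree T G \<pi>\<^sub>0 \<nu> \<Longrightarrow> w \<in> T G \<pi>\<^sub>0 \<mu> \<Longrightarrow> \<mu> @ [w] \<in> subtree T G \<pi>\<^sub>0 \<nu>"

abbreviation search_tree ::
  "(nat set set \<Rightarrow> (nat \<Rightarrow> nat) \<Rightarrow> nat list \<Rightarrow> nat set) \<Rightarrow> nat set set \<Rightarrow> (nat \<Rightarrow> nat) \<Rightarrow>
    nat list set"
  where "search_tree T G \<pi>\<^sub>0 \<equiv> subtree T G \<pi>\<^sub>0 []"

definition leaves ::
  "nat \<Rightarrow> (nat set set \<Rightarrow> (nat \<Rightarrow> nat) \<Rightarrow> nat list \<Rightarrow> (nat \<Rightarrow> nat)) \<Rightarrow>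
    (nat set set \<Rightarrow> (nat \<Rightarrow> nat) \<Rightarrow> nat list \<Rightarrow> nat set) \<Rightarrow> nat set set \<Rightarrow> (nat \<Rightarrow> nat) \<Rightarrow>
    nat list set"
  where "leaves n R T G \<pi>\<^sub>0 = {\<nu> \<in> search_tree T G \<pi>\<^sub>0. discrete n (R G \<pi>\<^sub>0 \<nu>)}"

definition node_invariant ::
  "nat \<Rightarrow> (nat set set \<Rightarrow> (nat \<Rightarrow> nat) \<Rightarrow> nat list \<Rightarrow> (nat \<Rightarrow> nat)) \<Rightarrow>
    (nat set set \<Rightarrow> (nat \<Rightarrow> nat) \<Rightarrow> nat list \<Rightarrow> nat set) \<Rightarrow>
    (nat set set \<Rightarrow> (nat \<Rightarrow> nat) \<Rightarrow> nat list \<Rightarrow> 'o::linorder) \<Rightarrow> bool"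
  where "node_invariant n R T \<phi> \<longleftrightarrow>
    (\<forall>\<pi>\<^sub>0\<in>colourings n. \<forall>G\<in>graphs n.
      \<forall>\<nu>\<in>search_tree T G \<pi>\<^sub>0. \<forall>\<nu>'\<in>search_tree T G \<pi>\<^sub>0. \<nu> \<noteq> \<nu>' \<longrightarrow>
        (length \<nu> = length \<nu>' \<and> \<phi> G \<pi>\<^sub>0 \<nu> < \<phi> G \<pi>\<^sub>0 \<nu>' \<longrightarrow>
          (\<forall>\<nu>\<^sub>1 \<in> leaves n R T G \<pi>\<^sub>0 \<inter> subtree T G \<pi>\<^sub>0 \<nu>.
           \<forall>\<nu>\<^sub>1' \<in> leaves n R T G \<pi>\<^sub>0 \<inter> subtree T G \<pi>\<^sub>0 \<nu>'. \<phi> G \<pi>\<^sub>0 \<nu>\<^sub>1 < \<phi> G \<pi>\<^sub>0 \<nu>\<^sub>1')) \<and>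
        (discrete n (R G \<pi>\<^sub>0 \<nu>) \<and> discrete n (R G \<pi>\<^sub>0 \<nu>') \<longrightarrow>
          (\<phi> G \<pi>\<^sub>0 \<nu> = \<phi> G \<pi>\<^sub>0 \<nu>' \<longleftrightarrow>
            graph_act (R G \<pi>\<^sub>0 \<nu>) G = graph_act (R G \<pi>\<^sub>0 \<nu>') G)) \<and>
        (\<forall>g\<in>carrier (sym_group n).
          \<phi> (graph_act g G) (col_act g \<pi>\<^sub>0) (map g \<nu>) = \<phi> G \<pi>\<^sub>0 \<nu>))"

definition max_leaf_invariant ::
  "nat \<Rightarrow> (nat set set \<Rightarrow> (nat \<Rightarrow> nat) \<Rightarrow> nat list \<Rightarrow> (nat \<Rightarrow> nat)) \<Rightarrow>
    (nat set set \<Rightarrow> (nat \<Rightarrow> nat) \<Rightarrow> nat list \<Rightarrow> nat set) \<Rightarrow>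
    (nat set set \<Rightarrow> (nat \<Rightarrow> nat) \<Rightarrow> nat list \<Rightarrow> 'o::linorder) \<Rightarrow> nat set set \<Rightarrow> (nat \<Rightarrow> nat) \<Rightarrow> 'o"
  where "max_leaf_invariant n R T \<phi> G \<pi>\<^sub>0 = Max (\<phi> G \<pi>\<^sub>0 ` leaves n R T G \<pi>\<^sub>0)"

datatype prune_op =
    is_PA: PA "nat list" "nat list"
  | is_PB: PB "nat list" "nat list"
  | is_PC: PC "nat list" "nat \<Rightarrow> nat"

text \<open>
  The side conditions refer to the unpruned search tree: the nodes of an operation may have been
  removed by earlier operations.
\<close>

fun admissible ::
  "nat \<Rightarrow> (nat set set \<Rightarrow> (nat \<Rightarrow> nat) \<Rightarrow> nat list \<Rightarrow> nat set) \<Rightarrow>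
    (nat set set \<Rightarrow> (nat \<Rightarrow> nat) \<Rightarrow> nat list \<Rightarrow> 'o::linorder) \<Rightarrow> nat set set \<Rightarrow> (nat \<Rightarrow> nat) \<Rightarrow>
    prune_op \<Rightarrow> bool" where
  "admissible n T \<phi> G \<pi>\<^sub>0 (PA \<nu> \<nu>') \<longleftrightarrow>
    \<nu> \<in> search_tree T G \<pi>\<^sub>0 \<and> \<nu>' \<in> search_tree T G \<pi>\<^sub>0 \<and> \<nu> \<noteq> \<nu>' \<and>
    length \<nu> = length \<nu>' \<and> \<phi> G \<pi>\<^sub>0 \<nu> > \<phi> G \<pi>\<^sub>0 \<nu>'"
| "admissible n T \<phi> G \<pi>\<^sub>0 (PB \<nu> \<nu>') \<longleftrightarrow>
    \<nu> \<in> search_tree T G \<pi>\<^sub>0 \<and> \<nu>' \<in> search_tree T G \<pi>\<^sub>0 \<and> \<nu> \<noteq> \<nu>' \<and>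
    length \<nu> = length \<nu>' \<and> \<phi> G \<pi>\<^sub>0 \<nu> \<noteq> \<phi> G \<pi>\<^sub>0 \<nu>'"
| "admissible n T \<phi> G \<pi>\<^sub>0 (PC \<nu> g) \<longleftrightarrow>
    g \<in> Aut n G \<pi>\<^sub>0 \<and> \<nu> \<in> search_tree T G \<pi>\<^sub>0 \<and> map g \<nu> \<in> search_tree T G \<pi>\<^sub>0 \<and>
    (\<nu>, map g \<nu>) \<in> lexord less_than"

fun removed ::
  "(nat set set \<Rightarrow> (nat \<Rightarrow> nat) \<Rightarrow> nat list \<Rightarrow> nat set) \<Rightarrow> nat set set \<Rightarrow> (nat \<Rightarrow> nat) \<Rightarrow>
    prune_op \<Rightarrow> nat list set" where
  "removed T G \<pi>\<^sub>0 (PA \<nu> \<nu>') = subtree T G \<pi>\<^sub>0 \<nu>'"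
| "removed T G \<pi>\<^sub>0 (PB \<nu> \<nu>') = subtree T G \<pi>\<^sub>0 \<nu>'"
| "removed T G \<pi>\<^sub>0 (PC \<nu> g) = subtree T G \<pi>\<^sub>0 (map g \<nu>)"

definition remaining_leaves ::
  "nat \<Rightarrow> (nat set set \<Rightarrow> (nat \<Rightarrow> nat) \<Rightarrow> nat list \<Rightarrow> (nat \<Rightarrow> nat)) \<Rightarrow>
    (nat set set \<Rightarrow> (nat \<Rightarrow> nat) \<Rightarrow> nat list \<Rightarrow> nat set) \<Rightarrow> nat set set \<Rightarrow> (nat \<Rightarrow> nat) \<Rightarrow>
    prune_op list \<Rightarrow> nat list set"
  where "remaining_leaves n R T G \<pi>\<^sub>0 ops =
    leaves n R T G \<pi>\<^sub>0 - (\<Union>op\<in>set ops. removed T G \<pi>\<^sub>0 op)"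

text \<open>
  An operation allowed in the presence of a fixed leaf \<open>\<nu>\<^sub>0\<close>. The node removed by an operation
  \<open>PB \<nu> \<nu>'\<close> must be distinguished by \<open>\<phi>\<close> from the ancestor of \<open>\<nu>\<^sub>0\<close> on its level, if there is one;
  otherwise such operations could remove all leaves equivalent to \<open>\<nu>\<^sub>0\<close> without contributing any
  automorphism. Operations \<open>PC \<nu> g\<close> need no such condition, as their automorphisms are recorded.
\<close>

fun allowed_for_leaf ::
  "(nat set set \<Rightarrow> (nat \<Rightarrow> nat) \<Rightarrow> nat list \<Rightarrow> 'o::linorder) \<Rightarrow> nat set set \<Rightarrow> (nat \<Rightarrow> nat) \<Rightarrow>
    nat list \<Rightarrow> prune_op \<Rightarrow> bool" where
  "allowed_for_leaf \<phi> G \<pi>\<^sub>0 \<nu>\<^sub>0 (PA \<nu> \<nu>') \<longleftrightarrow> False"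
| "allowed_for_leaf \<phi> G \<pi>\<^sub>0 \<nu>\<^sub>0 (PB \<nu> \<nu>') \<longleftrightarrow>
    (length \<nu>' \<le> length \<nu>\<^sub>0 \<longrightarrow> \<phi> G \<pi>\<^sub>0 \<nu>' \<noteq> \<phi> G \<pi>\<^sub>0 (take (length \<nu>') \<nu>\<^sub>0))"
| "allowed_for_leaf \<phi> G \<pi>\<^sub>0 \<nu>\<^sub>0 (PC \<nu> g) \<longleftrightarrow> True"

end

theory Submission
  imports Defs "HOL-Library.List_Lexorder"
begin

text \<open>
  Automorphisms of the coloured graph act on the search tree, preserving leaves and node invariants.
  An operation \<open>PC \<nu> g\<close> can therefore remove a leaf only if the inverse of \<open>g\<close> maps that leaf to
  a lexicographically smaller one. As an operation \<open>PA \<nu> \<nu>'\<close> removes no leaf attaining the maximal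
  invariant, the least such leaf survives, which gives (a). For (b), suppose that \<open>h\<close> is an
  automorphism outside the generated group for which \<open>map h \<nu>\<^sub>0\<close> is least. This leaf has been
  removed, and not by an operation \<open>PB \<nu> \<nu>'\<close>, because its ancestors have the invariants of those
  of \<open>\<nu>\<^sub>0\<close>. So it was removed by some \<open>PC \<nu> g\<close>; but then \<open>g\<inverse> h\<close> contradicts minimality.
\<close>

section \<open>Least sequences in the lexicographic order\<close>

lemma finite_lexord_minimal:
  fixes S :: "nat list set"
  assumes "finite S" and "S \<noteq> {}"
  obtains m where "m \<in> S" and "\<And>x. x \<in> S \<Longrightarrow> (x, m) \<notin> lexord less_than"
proof
  show "Min S \<in> S"
    using assms by (rule Min_in)
  fix x assume "x \<in> S"
  then have "Min S \<le> x"
    using assms(1) by (rule Min_le[rotated])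
  then have "\<not> x < Min S"
    by simp
  \<comment> \<open>The linear order on lists that \<open>Min\<close> uses is \<open>lexord\<close>
    over this set of pairs, so the two descriptions of the order have to be matched.\<close>
  moreover have "less_than = {(u, v). u < v}"
    by auto
  ultimately show "(x, Min S) \<notin> lexord less_than"
    by (simp add: list_less_def)
qed

section \<open>Permutations acting on graphs and colourings; the automorphism group\<close>

lemma graph_act_id [simp]: "graph_act id G = G"
  by (simp add: graph_act_def)

lemma graph_act_comp: "graph_act (g \<circ> h) G = graph_act g (graph_act h G)"
  by (simp add: graph_act_def image_comp comp_def)

lemma col_act_id [simp]: "col_act id \<pi> = \<pi>"
  by (simp add: col_act_def)

text \<open>Inverting reverses the order of composition and precomposing with inverses reverses it
  again; bijectivity is what lets the inverse of a composition split.\<close>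

lemma col_act_comp: "bij g \<Longrightarrow> bij h \<Longrightarrow> col_act (g \<circ> h) \<pi> = col_act g (col_act h \<pi>)"
  by (simp add: col_act_def o_inv_distrib comp_assoc)

lemma Aut_permutes: "g \<in> Aut n G \<pi> \<Longrightarrow> g permutes vertices n"
  by (simp add: Aut_def sym_group_def)

lemma map_inv_Aut:
  assumes "g \<in> Aut n G \<pi>"
  shows "map (Hilbert_Choice.inv g) (map g \<nu>) = \<nu>"
  using permutes_inv_o(2)[OF Aut_permutes[OF assms]] by simp

lemma Aut_comp: "g \<in> Aut n G \<pi> \<Longrightarrow> h \<in> Aut n G \<pi> \<Longrightarrow> g \<circ> h \<in> Aut n G \<pi>"
  by (auto simp: Aut_def sym_group_def graph_act_comp col_act_comp permutes_bij permutes_compose)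

lemma Aut_inv:
  assumes "g \<in> Aut n G \<pi>"
  shows "Hilbert_Choice.inv g \<in> Aut n G \<pi>"
proof -
  have g: "g permutes vertices n"
    using assms by (rule Aut_permutes)
  then have i: "Hilbert_Choice.inv g permutes vertices n"
    by (rule permutes_inv)
  have "graph_act (Hilbert_Choice.inv g) (graph_act g G) = G"
    using g by (simp add: graph_act_comp[symmetric] permutes_inv_o)
  moreover have "col_act (Hilbert_Choice.inv g) (col_act g \<pi>) = \<pi>"
    using g i by (simp add: col_act_comp[symmetric] permutes_bij permutes_inv_o)
  ultimately show ?thesis
    using assms i by (simp add: Aut_def sym_group_def)
qed

lemma subgroup_Aut: "subgroup (Aut n G \<pi>) (sym_group n)"
proof (rule group.subgroupI[OF sym_group_is_group])
  show "Aut n G \<pi> \<subseteq> carrier (sym_group n)"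
    by (auto simp: Aut_def)
  show "Aut n G \<pi> \<noteq> {}"
    using permutes_id[of "vertices n"] by (auto simp: Aut_def sym_group_def intro!: exI[of _ id])
  show "m_inv (sym_group n) g \<in> Aut n G \<pi>" if "g \<in> Aut n G \<pi>" for g
    using that Aut_inv by (simp add: sym_group_inv_equality Aut_def)
  show "g \<otimes>\<^bsub>sym_group n\<^esub> h \<in> Aut n G \<pi>" if "g \<in> Aut n G \<pi>" "h \<in> Aut n G \<pi>" for g h
    using Aut_comp[OF that] by (simp add: sym_group_def)
qed

section \<open>Cells and subtrees\<close>

lemma cells_nonempty: "C \<in> cells n \<pi> \<Longrightarrow> C \<noteq> {}"
  by (auto simp: cells_def)

lemma cells_subset: "C \<in> cells n \<pi> \<Longrightarrow> C \<subseteq> vertices n"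
  by (auto simp: cells_def)

lemma cells_eq: "C \<in> cells n \<pi> \<Longrightarrow> D \<in> cells n \<pi> \<Longrightarrow> v \<in> C \<Longrightarrow> v \<in> D \<Longrightarrow> C = D"
  by (auto simp: cells_def)

lemma subtree_extends: "\<mu> \<in> subtree T G \<pi> \<nu> \<Longrightarrow> \<exists>xs. \<mu> = \<nu> @ xs"
  by (induction rule: subtree.induct) auto

lemma subtree_trans:
  "\<mu> \<in> subtree T G \<pi> \<nu> \<Longrightarrow> \<nu> \<in> subtree T G \<pi> \<kappa> \<Longrightarrow> \<mu> \<in> subtree T G \<pi> \<kappa>"
  by (induction rule: subtree.induct) (auto intro: subtree.intros)

text \<open>Since \<open>child\<close> appends at the end, stripping the last entry of a node yields
  its parent; hence the induction on \<open>xs\<close> from the right.\<close>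

lemma search_tree_append:
  "\<nu> @ xs \<in> search_tree T G \<pi> \<Longrightarrow> \<nu> \<in> search_tree T G \<pi>"
proof (induction xs rule: rev_induct)
  case (snoc x xs)
  from snoc.prems have "\<nu> @ xs \<in> search_tree T G \<pi>"
    by (cases rule: subtree.cases) auto
  then show ?case
    by (rule snoc.IH)
qed simp

section \<open>The search tree of a fixed coloured graph: finiteness and leaves\<close>

locale search_tree_pruning =
  fixes n :: nat
    and R :: "nat set set \<Rightarrow> (nat \<Rightarrow> nat) \<Rightarrow> nat list \<Rightarrow> (nat \<Rightarrow> nat)"
    and T :: "nat set set \<Rightarrow> (nat \<Rightarrow> nat) \<Rightarrow> nat list \<Rightarrow> nat set"
    and \<phi> :: "nat set set \<Rightarrow> (nat \<Rightarrow> nat) \<Rightarrow> nat list \<Rightarrow> 'o::linorder"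
    and G :: "nat set set"
    and \<pi>\<^sub>0 :: "nat \<Rightarrow> nat"
  assumes R: "refinement_function n R"
    and T: "target_cell_selector n R T"
    and phi: "node_invariant n R T \<phi>"
    and G: "G \<in> graphs n"
    and pi: "\<pi>\<^sub>0 \<in> colourings n"
begin

abbreviation "tree \<equiv> search_tree T G \<pi>\<^sub>0"
abbreviation "leafs \<equiv> leaves n R T G \<pi>\<^sub>0"

lemma target_cell:
  assumes "\<nu> \<in> lists (vertices n)" "\<not> discrete n (R G \<pi>\<^sub>0 \<nu>)"
  shows "T G \<pi>\<^sub>0 \<nu> \<in> cells n (R G \<pi>\<^sub>0 \<nu>)" "\<not> is_singleton (T G \<pi>\<^sub>0 \<nu>)"
  using T G pi assms unfolding target_cell_selector_def by blast+

text \<open>Cells are nonempty, so (T1) has a converse. Leaves can thus be recognised from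
  \<open>T\<close>, whose values automorphisms permute.\<close>

lemma discrete_iff_target_empty:
  assumes "\<nu> \<in> lists (vertices n)"
  shows "discrete n (R G \<pi>\<^sub>0 \<nu>) \<longleftrightarrow> T G \<pi>\<^sub>0 \<nu> = {}"
  using T G pi assms target_cell(1)[OF assms] cells_nonempty
  unfolding target_cell_selector_def by blast

lemma target_subset: "\<nu> \<in> lists (vertices n) \<Longrightarrow> T G \<pi>\<^sub>0 \<nu> \<subseteq> vertices n"
  using discrete_iff_target_empty target_cell(1) cells_subset by blast

text \<open>By (R2) each vertex of the sequence forms a singleton cell; a target cell containing it
  would coincide with that cell, against (T2).\<close>

lemma target_disjoint:
  assumes "\<nu> \<in> lists (vertices n)" "w \<in> T G \<pi>\<^sub>0 \<nu>"
  shows "w \<notin> set \<nu>"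
proof
  assume "w \<in> set \<nu>"
  then have "{w} \<in> cells n (R G \<pi>\<^sub>0 \<nu>)"
    using R G pi assms(1) unfolding refinement_function_def by blast
  moreover have "\<not> discrete n (R G \<pi>\<^sub>0 \<nu>)"
    using discrete_iff_target_empty[OF assms(1)] assms(2) by blast
  ultimately have "T G \<pi>\<^sub>0 \<nu> = {w}"
    using target_cell(1)[OF assms(1)] assms(2) cells_eq by blast
  then show False
    using target_cell(2)[OF assms(1) \<open>\<not> discrete n (R G \<pi>\<^sub>0 \<nu>)\<close>] by (simp add: is_singleton_def)
qed

lemma tree_distinct: "\<nu> \<in> tree \<Longrightarrow> \<nu> \<in> lists (vertices n) \<and> distinct \<nu>"
proof (induction rule: subtree.induct)
  case (child \<mu> w)
  then show ?case
    using target_subset[of \<mu>] target_disjoint[of \<mu> w] by auto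
qed simp

lemma tree_lists: "\<nu> \<in> tree \<Longrightarrow> \<nu> \<in> lists (vertices n)"
  using tree_distinct by blast

text \<open>A node has no repeated entries, so its length is at most \<open>n\<close>.\<close>

lemma finite_tree: "finite tree"
proof (rule finite_subset)
  show "tree \<subseteq> {xs. set xs \<subseteq> vertices n \<and> length xs \<le> n}"
  proof (intro subsetI CollectI)
    fix \<nu> assume "\<nu> \<in> tree"
    then have *: "set \<nu> \<subseteq> vertices n" "distinct \<nu>"
      using tree_distinct by auto
    then show "set \<nu> \<subseteq> vertices n \<and> length \<nu> \<le> n"
      using card_mono[OF finite_atLeastAtMost *(1)] by (simp add: distinct_card)
  qed
qed (simp add: finite_lists_length_le)

lemma leaf_iff: "\<nu> \<in> leafs \<longleftrightarrow> \<nu> \<in> tree \<and> T G \<pi>\<^sub>0 \<nu> = {}"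
  unfolding leaves_def using discrete_iff_target_empty tree_lists by blast

lemma finite_leaves: "finite leafs"
  using finite_tree by (rule finite_subset[rotated]) (auto simp: leaves_def)

lemma leaf_below:
  assumes "\<nu> \<in> tree"
  obtains \<mu> where "\<mu> \<in> leafs \<inter> subtree T G \<pi>\<^sub>0 \<nu>"
proof -
  have sub: "subtree T G \<pi>\<^sub>0 \<nu> \<subseteq> tree"
    using assms subtree_trans by blast
  then have fin: "finite (length ` subtree T G \<pi>\<^sub>0 \<nu>)"
    using finite_tree finite_subset by blast
  \<comment> \<open>A descendant of maximal length has no child, so its target cell is
    empty.\<close>
  have "Max (length ` subtree T G \<pi>\<^sub>0 \<nu>) \<in> length ` subtree T G \<pi>\<^sub>0 \<nu>"
    using fin subtree.top[of \<nu> T G \<pi>\<^sub>0] by (intro Max_in) auto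
  then obtain \<mu> where \<mu>: "\<mu> \<in> subtree T G \<pi>\<^sub>0 \<nu>"
    and max: "length \<mu> = Max (length ` subtree T G \<pi>\<^sub>0 \<nu>)"
    by auto
  have "T G \<pi>\<^sub>0 \<mu> = {}"
  proof (rule ccontr)
    assume "T G \<pi>\<^sub>0 \<mu> \<noteq> {}"
    then obtain w where "\<mu> @ [w] \<in> subtree T G \<pi>\<^sub>0 \<nu>"
      using \<mu> subtree.child by blast
    then have "length (\<mu> @ [w]) \<le> length \<mu>"
      unfolding max using fin by (intro Max_ge imageI)
    then show False
      by simp
  qed
  then show thesis
    using that \<mu> sub leaf_iff by blast
qed

section \<open>Automorphisms acting on the tree\<close>

text \<open>An automorphism fixes \<open>G\<close> and \<open>\<pi>\<^sub>0\<close>, so (T3)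
  compares two sequences within one tree.\<close>

lemma Aut_target:
  assumes "g \<in> Aut n G \<pi>\<^sub>0" "\<nu> \<in> tree"
  shows "T G \<pi>\<^sub>0 (map g \<nu>) = g ` T G \<pi>\<^sub>0 \<nu>"
proof -
  have "\<forall>g\<in>carrier (sym_group n). T (graph_act g G) (col_act g \<pi>\<^sub>0) (map g \<nu>) = g ` T G \<pi>\<^sub>0 \<nu>"
    using T G pi tree_lists[OF assms(2)] unfolding target_cell_selector_def by blast
  then show ?thesis
    using assms(1) by (auto simp: Aut_def)
qed

lemma Aut_tree:
  assumes "g \<in> Aut n G \<pi>\<^sub>0"
  shows "\<nu> \<in> tree \<Longrightarrow> map g \<nu> \<in> tree"
proof (induction rule: subtree.induct)
  case (child \<mu> w)
  then have "g w \<in> T G \<pi>\<^sub>0 (map g \<mu>)"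
    using Aut_target[OF assms] by blast
  then show ?case
    using subtree.child[OF child.IH] by simp
qed (simp add: subtree.top)

lemma Aut_leaf: "g \<in> Aut n G \<pi>\<^sub>0 \<Longrightarrow> \<nu> \<in> leafs \<Longrightarrow> map g \<nu> \<in> leafs"
  by (simp add: leaf_iff Aut_tree Aut_target)

text \<open>
  The axioms constrain \<open>\<phi>\<close> only on pairs of distinct nodes; the pair needed here consists of \<open>\<nu>\<close>
  and its image, and there is nothing to show if they coincide.
\<close>

lemma Aut_invariant:
  assumes "g \<in> Aut n G \<pi>\<^sub>0" "\<nu> \<in> tree"
  shows "\<phi> G \<pi>\<^sub>0 (map g \<nu>) = \<phi> G \<pi>\<^sub>0 \<nu>"
proof (cases "map g \<nu> = \<nu>")
  case False
  then have "\<forall>g\<in>carrier (sym_group n).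
      \<phi> (graph_act g G) (col_act g \<pi>\<^sub>0) (map g \<nu>) = \<phi> G \<pi>\<^sub>0 \<nu>"
    using phi G pi assms(2) Aut_tree[OF assms] unfolding node_invariant_def by metis
  then show ?thesis
    using assms(1) by (auto simp: Aut_def)
qed simp

section \<open>What pruning operations can remove\<close>

lemma invariant_less:
  assumes "\<nu> \<in> tree" "\<nu>' \<in> tree" "length \<nu> = length \<nu>'" "\<phi> G \<pi>\<^sub>0 \<nu> < \<phi> G \<pi>\<^sub>0 \<nu>'"
    and "\<mu> \<in> leafs \<inter> subtree T G \<pi>\<^sub>0 \<nu>" "\<mu>' \<in> leafs \<inter> subtree T G \<pi>\<^sub>0 \<nu>'"
  shows "\<phi> G \<pi>\<^sub>0 \<mu> < \<phi> G \<pi>\<^sub>0 \<mu>'"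
proof -
  have "\<nu> \<noteq> \<nu>'"
    using assms(4) by auto
  then show ?thesis
    using phi pi G assms unfolding node_invariant_def by blast
qed

lemma inv_less_of_removed_PC:
  assumes "admissible n T \<phi> G \<pi>\<^sub>0 (PC \<nu> g)" "\<mu> \<in> removed T G \<pi>\<^sub>0 (PC \<nu> g)"
  shows "(map (Hilbert_Choice.inv g) \<mu>, \<mu>) \<in> lexord less_than"
proof -
  obtain xs where \<mu>: "\<mu> = map g \<nu> @ xs"
    using assms(2) subtree_extends by fastforce
  have "map (Hilbert_Choice.inv g) \<mu> = \<nu> @ map (Hilbert_Choice.inv g) xs"
    unfolding \<mu> map_append using assms(1) map_inv_Aut[of g n G \<pi>\<^sub>0 \<nu>] by simp
  \<comment> \<open>The prefixes \<open>\<nu>\<close> and \<open>map g \<nu>\<close> have equal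
    length, so they already differ at some position and the comparison survives any
    continuation.\<close>
  then show ?thesis
    unfolding \<mu> using assms(1) by (simp add: lexord_sufI)
qed

section \<open>Survival of a leaf with maximal invariant\<close>

lemma maximal_leaf_remains:
  assumes ops: "\<And>op. op \<in> set ops \<Longrightarrow> admissible n T \<phi> G \<pi>\<^sub>0 op \<and> (is_PA op \<or> is_PC op)"
  shows "\<exists>\<nu>\<in>remaining_leaves n R T G \<pi>\<^sub>0 ops. \<phi> G \<pi>\<^sub>0 \<nu> = max_leaf_invariant n R T \<phi> G \<pi>\<^sub>0"
proof -
  let ?m = "max_leaf_invariant n R T \<phi> G \<pi>\<^sub>0"
  have ge: "\<phi> G \<pi>\<^sub>0 \<mu> \<le> ?m" if "\<mu> \<in> leafs" for \<mu>
    unfolding max_leaf_invariant_def using that finite_leaves by (intro Max_ge) auto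
  have "leafs \<noteq> {}"
    using leaf_below[OF subtree.top] by blast
  then have "?m \<in> \<phi> G \<pi>\<^sub>0 ` leafs"
    unfolding max_leaf_invariant_def using finite_leaves by (intro Max_in) auto
  then have "{\<nu> \<in> leafs. \<phi> G \<pi>\<^sub>0 \<nu> = ?m} \<noteq> {}"
    by auto
  moreover have "finite {\<nu> \<in> leafs. \<phi> G \<pi>\<^sub>0 \<nu> = ?m}"
    using finite_leaves by simp
  ultimately obtain \<mu> where "\<mu> \<in> {\<nu> \<in> leafs. \<phi> G \<pi>\<^sub>0 \<nu> = ?m}"
    and min: "\<And>\<kappa>. \<kappa> \<in> {\<nu> \<in> leafs. \<phi> G \<pi>\<^sub>0 \<nu> = ?m} \<Longrightarrow> (\<kappa>, \<mu>) \<notin> lexord less_than"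
    using finite_lexord_minimal by blast
  then have \<mu>: "\<mu> \<in> leafs" "\<phi> G \<pi>\<^sub>0 \<mu> = ?m"
    by auto
  have "\<mu> \<notin> removed T G \<pi>\<^sub>0 op" if "op \<in> set ops" for op
  proof
    assume rem: "\<mu> \<in> removed T G \<pi>\<^sub>0 op"
    show False
    proof (cases op)
      case (PA \<nu> \<nu>')
      then have adm: "\<nu> \<in> tree" "\<nu>' \<in> tree" "length \<nu>' = length \<nu>" "\<phi> G \<pi>\<^sub>0 \<nu>' < \<phi> G \<pi>\<^sub>0 \<nu>"
        using ops[OF that] by auto
      \<comment> \<open>By (\<phi>1) any leaf below \<nu> would have a larger invariant than \<mu>,
        so one such leaf suffices to contradict maximality.\<close>
      obtain \<kappa> where \<kappa>: "\<kappa> \<in> leafs \<inter> subtree T G \<pi>\<^sub>0 \<nu>"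
        using leaf_below[OF adm(1)] .
      have "\<phi> G \<pi>\<^sub>0 \<mu> < \<phi> G \<pi>\<^sub>0 \<kappa>"
        using rem PA \<mu>(1) by (intro invariant_less[OF adm(2,1,3,4) _ \<kappa>]) auto
      then show False
        using ge[of \<kappa>] \<kappa> \<mu>(2) by auto
    next
      case (PC \<nu> g)
      then have adm: "admissible n T \<phi> G \<pi>\<^sub>0 (PC \<nu> g)"
        using ops[OF that] by blast
      then have g: "Hilbert_Choice.inv g \<in> Aut n G \<pi>\<^sub>0"
        using Aut_inv by simp
      \<comment> \<open>The preimage of \<mu> also attains the maximum, yet it is lexicographically
        smaller.\<close>
      have "\<phi> G \<pi>\<^sub>0 (map (Hilbert_Choice.inv g) \<mu>) = ?m"
        using Aut_invariant[OF g] \<mu> by (simp add: leaf_iff)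
      then show False
        using min inv_less_of_removed_PC[OF adm] rem PC Aut_leaf[OF g \<mu>(1)] by blast
    qed (use ops[OF that] in auto)
  qed
  then show ?thesis
    using \<mu> by (auto simp: remaining_leaves_def)
qed

section \<open>Generators of the automorphism group\<close>

lemma Aut_generated:
  assumes leaf: "\<nu>\<^sub>0 \<in> leafs"
    and ops: "\<And>op. op \<in> set ops \<Longrightarrow>
      admissible n T \<phi> G \<pi>\<^sub>0 op \<and> allowed_for_leaf \<phi> G \<pi>\<^sub>0 \<nu>\<^sub>0 op"
  shows "generate (sym_group n)
      ({g. \<exists>\<nu>. PC \<nu> g \<in> set ops} \<union>
       {g \<in> Aut n G \<pi>\<^sub>0. map g \<nu>\<^sub>0 \<in> remaining_leaves n R T G \<pi>\<^sub>0 ops}) = Aut n G \<pi>\<^sub>0"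
    (is "generate _ ?S = _")
proof
  \<comment> \<open>Admissibility of the operations \<open>PC\<close> makes the recorded
    permutations automorphisms.\<close>
  have "?S \<subseteq> Aut n G \<pi>\<^sub>0"
    using ops by fastforce
  then show "generate (sym_group n) ?S \<subseteq> Aut n G \<pi>\<^sub>0"
    using group.generate_subgroup_incl[OF sym_group_is_group _ subgroup_Aut] by blast
  show "Aut n G \<pi>\<^sub>0 \<subseteq> generate (sym_group n) ?S"
  proof (rule ccontr)
    let ?B = "Aut n G \<pi>\<^sub>0 - generate (sym_group n) ?S"
    assume "\<not> Aut n G \<pi>\<^sub>0 \<subseteq> generate (sym_group n) ?S"
    then have "(\<lambda>h. map h \<nu>\<^sub>0) ` ?B \<noteq> {}"
      by blast
    \<comment> \<open>The images of the fixed leaf are themselves leaves, so there are only finitely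
      many and a least one exists.\<close>
    moreover have "(\<lambda>h. map h \<nu>\<^sub>0) ` ?B \<subseteq> leafs"
      using leaf Aut_leaf by blast
    then have "finite ((\<lambda>h. map h \<nu>\<^sub>0) ` ?B)"
      using finite_leaves by (rule finite_subset)
    ultimately obtain \<mu> where "\<mu> \<in> (\<lambda>h. map h \<nu>\<^sub>0) ` ?B"
      and min: "\<And>\<kappa>. \<kappa> \<in> (\<lambda>h. map h \<nu>\<^sub>0) ` ?B \<Longrightarrow> (\<kappa>, \<mu>) \<notin> lexord less_than"
      using finite_lexord_minimal by blast
    then obtain h where h: "h \<in> Aut n G \<pi>\<^sub>0" "h \<notin> generate (sym_group n) ?S"
      and \<mu>: "\<mu> = map h \<nu>\<^sub>0"
      by blast
    \<comment> \<open>If \<mu> remained, \<open>h\<close> would itself be one of the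
      generators.\<close>
    have "\<mu> \<notin> remaining_leaves n R T G \<pi>\<^sub>0 ops"
      using h \<mu> generate.incl[of h ?S] by blast
    then obtain op where op: "op \<in> set ops" and rem: "\<mu> \<in> removed T G \<pi>\<^sub>0 op"
      using Aut_leaf[OF h(1) leaf] \<mu> by (auto simp: remaining_leaves_def)
    show False
    proof (cases op)
      case (PB \<nu> \<nu>')
      obtain xs where xs: "map h \<nu>\<^sub>0 = \<nu>' @ xs"
        using rem PB \<mu> subtree_extends by fastforce
      then have \<nu>': "\<nu>' = map h (take (length \<nu>') \<nu>\<^sub>0)"
        by (simp add: take_map[symmetric])
      \<comment> \<open>This discharges the length guard in \<open>allowed_for_leaf\<close>, whose
        inequality of invariants is then refuted because \<open>h\<close> maps the ancestor of
        \<open>\<nu>\<^sub>0\<close> on this level to \<nu>'.\<close>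
      have len: "length \<nu>' \<le> length \<nu>\<^sub>0"
        using arg_cong[OF xs, of length] by simp
      have "take (length \<nu>') \<nu>\<^sub>0 \<in> tree"
        using leaf search_tree_append[of "take (length \<nu>') \<nu>\<^sub>0" "drop (length \<nu>') \<nu>\<^sub>0"]
        by (simp add: leaf_iff)
      then have "\<phi> G \<pi>\<^sub>0 \<nu>' = \<phi> G \<pi>\<^sub>0 (take (length \<nu>') \<nu>\<^sub>0)"
        using Aut_invariant[OF h(1)] \<nu>' by metis
      then show False
        using ops[OF op] PB len by simp
    next
      case (PC \<nu> g)
      then have adm: "admissible n T \<phi> G \<pi>\<^sub>0 (PC \<nu> g)"
        using ops[OF op] by blast
      then have g: "g \<in> Aut n G \<pi>\<^sub>0"
        by simp
      let ?k = "Hilbert_Choice.inv g \<circ> h"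
      have k: "?k \<in> Aut n G \<pi>\<^sub>0"
        using Aut_comp[OF Aut_inv[OF g] h(1)] .
      have "(map ?k \<nu>\<^sub>0, \<mu>) \<in> lexord less_than"
        using inv_less_of_removed_PC[OF adm, of \<mu>] rem PC \<mu> by simp
      \<comment> \<open>An automorphism with an image below \<mu> cannot lie in
        \<open>?B\<close>.\<close>
      then have "?k \<in> generate (sym_group n) ?S"
        using min k by blast
      moreover have "g \<in> generate (sym_group n) ?S"
        using op PC by (intro generate.incl) auto
      \<comment> \<open>Multiplying by the recorded \<open>g\<close> recovers \<open>h\<close>,
        which puts \<open>h\<close> into the generated group.\<close>
      ultimately have "g \<otimes>\<^bsub>sym_group n\<^esub> ?k \<in> generate (sym_group n) ?S"
        by (rule generate.eng[rotated])
      moreover have "g \<otimes>\<^bsub>sym_group n\<^esub> ?k = h"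
        using permutes_inv_o(1)[OF Aut_permutes[OF g]]
          by (simp add: sym_group_def comp_assoc[symmetric])
      ultimately show False
        using h(2) by simp
    \<comment> \<open>The remaining case \<open>PA\<close> is forbidden by
      \<open>allowed_for_leaf\<close>.\<close>
    qed (use ops[OF op] in auto)
  qed
qed

end

theorem theorem2p5:
  fixes n :: nat
    and R :: "nat set set \<Rightarrow> (nat \<Rightarrow> nat) \<Rightarrow> nat list \<Rightarrow> (nat \<Rightarrow> nat)"
    and T :: "nat set set \<Rightarrow> (nat \<Rightarrow> nat) \<Rightarrow> nat list \<Rightarrow> nat set"
    and \<phi> :: "nat set set \<Rightarrow> (nat \<Rightarrow> nat) \<Rightarrow> nat list \<Rightarrow> 'o::linorder"
    and G :: "nat set set"
    and \<pi>\<^sub>0 :: "nat \<Rightarrow> nat"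
  assumes "refinement_function n R"
    and "target_cell_selector n R T"
    and "node_invariant n R T \<phi>"
    and "G \<in> graphs n"
    and "\<pi>\<^sub>0 \<in> colourings n"
  shows
    "(\<forall>ops. (\<forall>op\<in>set ops. admissible n T \<phi> G \<pi>\<^sub>0 op \<and> (is_PA op \<or> is_PC op)) \<longrightarrow>
        (\<exists>\<nu>\<^sub>1\<in>remaining_leaves n R T G \<pi>\<^sub>0 ops. \<phi> G \<pi>\<^sub>0 \<nu>\<^sub>1 = max_leaf_invariant n R T \<phi> G \<pi>\<^sub>0)) \<and>
     (\<forall>\<nu>\<^sub>0\<in>leaves n R T G \<pi>\<^sub>0. \<forall>ops.
        (\<forall>op\<in>set ops. admissible n T \<phi> G \<pi>\<^sub>0 op \<and> allowed_for_leaf \<phi> G \<pi>\<^sub>0 \<nu>\<^sub>0 op) \<longrightarrow>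
        generate (sym_group n)
          ({g. \<exists>\<nu>. PC \<nu> g \<in> set ops} \<union>
           {g \<in> Aut n G \<pi>\<^sub>0. map g \<nu>\<^sub>0 \<in> remaining_leaves n R T G \<pi>\<^sub>0 ops}) = Aut n G \<pi>\<^sub>0)"
proof -
  interpret search_tree_pruning n R T \<phi> G \<pi>\<^sub>0
    using assms by unfold_locales
  show ?thesis
    using maximal_leaf_remains Aut_generated by blast
qed

end
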